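(* Let $D \subseteq B_m(S)$ be a set of functions that contains the constant functions and is a complete metric space under $d_\infty$. Suppose that $r$ is bounded. Assume that for every $f \in D$ we have $\Lambda_f \neq \emptyset$ and $Tf \in D$. Then the following hold. 1. The value function $V$ is the unique function in $D$ that satisfies the Bellman equation, i.e., $V \in D$, $TV = V$, and no other element of $D$ is a fixed point of $T$. 2. For every $\epsilon>0$ there is a stationary policy $\lambda \in \Lambda_V$ that is $\epsilon$-optimal. 3. If $\lambda \in \Lambda_V$ (i.e., $\lambda$ achieves the supremum in the Bellman equation for $V$ at every state), then $\lambda$ is an optimal stationary policy.
   Context: Discounted dynamic programming model (infinite horizon). $S$ (states) is a separable complete metric space with Borel $\sigma$-algebra $\mathcal{B}(S)$; measurable always means Borel measurable. $A \subseteq \mathbb{R}^k$ (actions) is a measurable set. $\Gamma$ assigns to each $s\in S$ a measurable set $\Gamma(s)\subseteq A$ of feasible actions. $p : S\times A\times \mathcal{B}(S)\to[0,1]$ is a transition probability: $p(s,a,\cdot)$ is a probability measure on $S$ for each $(s,a)$ and $p(\cdot,\cdot,B)$ is measurable for each $B\in\mathcal{B}(S)$. $r:S\times A\to\mathbb{R}$ is a measurable payoff function. $\beta\in(0,1)$ is the discount factor. Strategies: let $H^t = S\times (A\times S)^{t-1}$. A strategy $\sigma=(\sigma_1,\sigma_2,\dots)$ is a sequence of Borel measurable functions $\sigma_t:H^t\to A$ with $\sigma_t(s(1),a(1),\dots,s(t))\in\Gamma(s(t))$ for all $t$ and all histories. Given an initial state $s(1)=s$, $\sigma$ and $p$ induce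 a probability measure on infinite histories, with expectation $\mathbb{E}_\sigma$ and state-action process $\{s(t),a(t)\}_{t\ge1}$. Put $V_\sigma(s)=\mathbb{E}_\sigma\sum_{t=1}^\infty \beta^{t-1}r(s(t),a(t))$ and define the value function $V(s)=\sup_\sigma V_\sigma(s)$. A stationary policy is a measurable $\lambda:S\to A$ with $\lambda(s)\in\Gamma(s)$ for all $s$; it is identified with the strategy playing $\lambda(s(t))$ at every history. A strategy $\sigma$ is optimal if $V_\sigma(s)=V(s)$ for all $s$; for $\epsilon>0$ it is $\epsilon$-optimal if $V_{\sigma'}(s)\le V_\sigma(s)+\epsilon$ for every strategy $\sigma'$ and every $s\in S$. $B_m(S)$ is the space of bounded measurable functions $S\to\mathbb{R}$, with metric $d_\infty(f,g)=\sup_{s\in S}|f(s)-g(s)|$. For measurable $f$ let $Q(s,a,f)=r(s,a)+\beta\int_S f(s')\,p(s,a,ds')$ and define the Bellman operator $Tf(s)=\sup_{a\in\Gamma(s)}Q(s,a,f)$. Let $\Lambda_f$ be the set of measurable $\lambda:S\to A$ with $\lambda(s)\in\Gamma(s)$ and $Q(s,\lambda(s),f)=\sup_{a\in\Gamma(s)}Q(s,a,f)$ for all $s\in S$. *)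

theory Defs
  imports "HOL-Probability.Probability"
begin

text \<open>
  The state space is a type of class \<^class>\<open>polish_space\<close>, the action set a Borel set in
  \<^typ>\<open>real^'k\<close>; \<^term>\<open>p s a\<close> is the distribution of the next state. Nothing is
  assumed about \<^term>\<open>p s a\<close> and \<^term>\<open>r s a\<close> for actions outside \<^term>\<open>A\<close>.
\<close>

locale discounted_dp =
  fixes A :: "(real^'k) set"
    and \<Gamma> :: "'s::polish_space \<Rightarrow> (real^'k) set"
    and p :: "'s \<Rightarrow> (real^'k) \<Rightarrow> 's measure"
    and r :: "'s \<Rightarrow> (real^'k) \<Rightarrow> real"
    and \<beta> :: real
  assumes actions_measurable: "A \<in> sets borel"
    and feasible_subset: "\<And>s. \<Gamma> s \<subseteq> A"
    and feasible_measurable: "\<And>s. \<Gamma> s \<in> sets borel"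
    and transition_prob: "\<And>s a. a \<in> A \<Longrightarrow> prob_space (p s a)"
    and transition_sets: "\<And>s a. a \<in> A \<Longrightarrow> sets (p s a) = sets borel"
    and transition_measurable:
      "\<And>B. B \<in> sets borel \<Longrightarrow>
        (\<lambda>(s, a). measure (p s a) B) \<in> borel_measurable (borel \<Otimes>\<^sub>M restrict_space borel A)"
    and payoff_measurable:
      "(\<lambda>(s, a). r s a) \<in> borel_measurable (borel \<Otimes>\<^sub>M restrict_space borel A)"
    and discount_pos: "0 < \<beta>"
    and discount_less_1: "\<beta> < 1"

definition state_action_space :: "(real^'k) set \<Rightarrow> ('s::polish_space \<times> (real^'k)) measure" where
  "state_action_space A = borel \<Otimes>\<^sub>M restrict_space borel A"

text \<open>
  Time starts at 0. A history ending in the state at time \<open>t\<close> is stored as a pair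
  \<open>(\<omega>, s)\<close>: the \<open>t\<close> past state-action pairs \<open>\<omega> 0, \<dots>, \<omega> (t - 1)\<close> and the current
  state \<open>s\<close>. Thus \<open>S \<times> (A \<times> S)\<^sup>t\<close> is represented as \<open>(S \<times> A)\<^sup>t \<times> S\<close>. All spaces are second
  countable, so the product sigma-algebras are the Borel ones.
\<close>

definition history_space ::
    "(real^'k) set \<Rightarrow> nat \<Rightarrow> ((nat \<Rightarrow> 's::polish_space \<times> (real^'k)) \<times> 's) measure" where
  "history_space A t = PiM {0..<t} (\<lambda>_. state_action_space A) \<Otimes>\<^sub>M borel"

type_synonym ('s, 'k) strategy = "nat \<Rightarrow> (nat \<Rightarrow> 's \<times> (real^'k)) \<times> 's \<Rightarrow> (real^'k)"

definition strategies ::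
    "(real^'k) set \<Rightarrow> ('s::polish_space \<Rightarrow> (real^'k) set) \<Rightarrow> ('s, 'k) strategy set" where
  "strategies A \<Gamma> =
    {\<sigma>. \<forall>t. \<sigma> t \<in> history_space A t \<rightarrow>\<^sub>M restrict_space borel A \<and>
          (\<forall>h\<in>space (history_space A t). \<sigma> t h \<in> \<Gamma> (snd h))}"

definition stationary_policies ::
    "(real^'k) set \<Rightarrow> ('s::polish_space \<Rightarrow> (real^'k) set) \<Rightarrow> ('s \<Rightarrow> (real^'k)) set" where
  "stationary_policies A \<Gamma> =
    {l. l \<in> borel \<rightarrow>\<^sub>M restrict_space borel A \<and> (\<forall>s. l s \<in> \<Gamma> s)}"

definition stationary_strategy :: "('s \<Rightarrow> (real^'k)) \<Rightarrow> ('s::polish_space, 'k) strategy" where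
  "stationary_strategy l = (\<lambda>t h. l (snd h))"

text \<open>
  Conditional law of the state-action pair at time \<open>t\<close> given the pairs \<open>\<omega> 0, \<dots>, \<omega> (t - 1)\<close>:
  the new state is drawn from \<^term>\<open>p\<close> (it is the initial state if \<open>t = 0\<close>) and the action
  is the one \<^term>\<open>\<sigma>\<close> prescribes at the extended history.
\<close>

definition step_kernel ::
    "(real^'k) set \<Rightarrow> ('s::polish_space \<Rightarrow> (real^'k) \<Rightarrow> 's measure) \<Rightarrow> ('s, 'k) strategy \<Rightarrow> 's \<Rightarrow>
     nat \<Rightarrow> (nat \<Rightarrow> 's \<times> (real^'k)) \<Rightarrow> ('s \<times> (real^'k)) measure" where
  "step_kernel A p \<sigma> s t \<omega> =
    distr (case t of 0 \<Rightarrow> return borel s | Suc n \<Rightarrow> p (fst (\<omega> n)) (snd (\<omega> n)))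
      (state_action_space A) (\<lambda>s'. (s', \<sigma> t (\<omega>, s')))"

text \<open>The measure on infinite histories given by the Ionescu-Tulcea theorem.\<close>

definition path_measure ::
    "(real^'k) set \<Rightarrow> ('s::polish_space \<Rightarrow> (real^'k) \<Rightarrow> 's measure) \<Rightarrow> ('s, 'k) strategy \<Rightarrow> 's \<Rightarrow>
     (nat \<Rightarrow> 's \<times> (real^'k)) measure" where
  "path_measure A p \<sigma> s =
    projective_family.lim UNIV
      (Ionescu_Tulcea.CI (step_kernel A p \<sigma> s) (\<lambda>_. state_action_space A))
      (\<lambda>_. state_action_space A)"

definition strategy_value ::
    "(real^'k) set \<Rightarrow> ('s::polish_space \<Rightarrow> (real^'k) \<Rightarrow> 's measure) \<Rightarrow> ('s \<Rightarrow> (real^'k) \<Rightarrow> real) \<Rightarrow> real \<Rightarrow>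
     ('s, 'k) strategy \<Rightarrow> 's \<Rightarrow> real" where
  "strategy_value A p r \<beta> \<sigma> s =
    (\<integral>\<omega>. (\<Sum>t. \<beta> ^ t * r (fst (\<omega> t)) (snd (\<omega> t))) \<partial>path_measure A p \<sigma> s)"

definition value_function ::
    "(real^'k) set \<Rightarrow> ('s::polish_space \<Rightarrow> (real^'k) set) \<Rightarrow> ('s \<Rightarrow> (real^'k) \<Rightarrow> 's measure) \<Rightarrow>
     ('s \<Rightarrow> (real^'k) \<Rightarrow> real) \<Rightarrow> real \<Rightarrow> 's \<Rightarrow> real" where
  "value_function A \<Gamma> p r \<beta> s = (SUP \<sigma>\<in>strategies A \<Gamma>. strategy_value A p r \<beta> \<sigma> s)"

definition optimal_strategy ::
    "(real^'k) set \<Rightarrow> ('s::polish_space \<Rightarrow> (real^'k) set) \<Rightarrow> ('s \<Rightarrow> (real^'k) \<Rightarrow> 's measure) \<Rightarrow>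
     ('s \<Rightarrow> (real^'k) \<Rightarrow> real) \<Rightarrow> real \<Rightarrow> ('s, 'k) strategy \<Rightarrow> bool" where
  "optimal_strategy A \<Gamma> p r \<beta> \<sigma> \<longleftrightarrow>
    \<sigma> \<in> strategies A \<Gamma> \<and> (\<forall>s. strategy_value A p r \<beta> \<sigma> s = value_function A \<Gamma> p r \<beta> s)"

definition eps_optimal_strategy ::
    "(real^'k) set \<Rightarrow> ('s::polish_space \<Rightarrow> (real^'k) set) \<Rightarrow> ('s \<Rightarrow> (real^'k) \<Rightarrow> 's measure) \<Rightarrow>
     ('s \<Rightarrow> (real^'k) \<Rightarrow> real) \<Rightarrow> real \<Rightarrow> real \<Rightarrow> ('s, 'k) strategy \<Rightarrow> bool" where
  "eps_optimal_strategy A \<Gamma> p r \<beta> \<epsilon> \<sigma> \<longleftrightarrow>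
    \<sigma> \<in> strategies A \<Gamma> \<and>
    (\<forall>\<sigma>'\<in>strategies A \<Gamma>. \<forall>s. strategy_value A p r \<beta> \<sigma>' s \<le> strategy_value A p r \<beta> \<sigma> s + \<epsilon>)"

definition Q_value ::
    "('s::polish_space \<Rightarrow> (real^'k) \<Rightarrow> 's measure) \<Rightarrow> ('s \<Rightarrow> (real^'k) \<Rightarrow> real) \<Rightarrow> real \<Rightarrow>
     's \<Rightarrow> (real^'k) \<Rightarrow> ('s \<Rightarrow> real) \<Rightarrow> real" where
  "Q_value p r \<beta> s a f = r s a + \<beta> * (\<integral>s'. f s' \<partial>p s a)"

definition bellman ::
    "('s::polish_space \<Rightarrow> (real^'k) set) \<Rightarrow> ('s \<Rightarrow> (real^'k) \<Rightarrow> 's measure) \<Rightarrow>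
     ('s \<Rightarrow> (real^'k) \<Rightarrow> real) \<Rightarrow> real \<Rightarrow> ('s \<Rightarrow> real) \<Rightarrow> 's \<Rightarrow> real" where
  "bellman \<Gamma> p r \<beta> f s = (SUP a\<in>\<Gamma> s. Q_value p r \<beta> s a f)"

definition argmax_policies ::
    "(real^'k) set \<Rightarrow> ('s::polish_space \<Rightarrow> (real^'k) set) \<Rightarrow> ('s \<Rightarrow> (real^'k) \<Rightarrow> 's measure) \<Rightarrow>
     ('s \<Rightarrow> (real^'k) \<Rightarrow> real) \<Rightarrow> real \<Rightarrow> ('s \<Rightarrow> real) \<Rightarrow> ('s \<Rightarrow> (real^'k)) set" where
  "argmax_policies A \<Gamma> p r \<beta> f =
    {l \<in> stationary_policies A \<Gamma>.
      \<forall>s. Q_value p r \<beta> s (l s) f = (SUP a\<in>\<Gamma> s. Q_value p r \<beta> s a f)}"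

definition bounded_measurable :: "('s::polish_space \<Rightarrow> real) set" where
  "bounded_measurable = {f \<in> borel_measurable borel. bounded (range f)}"

text \<open>
  The value 0 outside \<^const>\<open>bounded_measurable\<close>, where the supremum need not exist, is a dummy:
  the locale \<^locale>\<open>Metric_space\<close> asks for a nonnegative symmetric function on the whole type.
\<close>

definition dist_inf :: "('s::polish_space \<Rightarrow> real) \<Rightarrow> ('s \<Rightarrow> real) \<Rightarrow> real" where
  "dist_inf f g =
    (if f \<in> bounded_measurable \<and> g \<in> bounded_measurable then SUP s. \<bar>f s - g s\<bar> else 0)"

lemma bdd_above_dist_inf:
  assumes "f \<in> bounded_measurable" "g \<in> bounded_measurable"
  shows "bdd_above (range (\<lambda>s. \<bar>f s - g s\<bar>))"
proof -
  from assms obtain B C where "\<And>s. \<bar>f s\<bar> \<le> B" "\<And>s. \<bar>g s\<bar> \<le> C"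
    unfolding bounded_measurable_def bounded_iff by auto
  then have "\<bar>f s - g s\<bar> \<le> B + C" for s
    by (meson abs_triangle_ineq4 add_mono order_trans)
  then show ?thesis by (intro bdd_aboveI[of _ "B + C"]) auto
qed

lemma Metric_space_bounded_measurable: "Metric_space bounded_measurable dist_inf"
proof
  note up = cSUP_upper[OF UNIV_I bdd_above_dist_inf]
  show "0 \<le> dist_inf f g" for f g :: "'a \<Rightarrow> real"
    unfolding dist_inf_def using order_trans[OF abs_ge_zero up] by auto
  show "dist_inf f g = dist_inf g f" for f g :: "'a \<Rightarrow> real"
    by (simp add: dist_inf_def abs_minus_commute)
  fix f g h :: "'a \<Rightarrow> real"
  assume fg: "f \<in> bounded_measurable" "g \<in> bounded_measurable"
  show "dist_inf f g = 0 \<longleftrightarrow> f = g"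
  proof
    assume "dist_inf f g = 0"
    then have "\<bar>f s - g s\<bar> \<le> 0" for s
      using up[OF fg, of s] fg by (simp add: dist_inf_def)
    then show "f = g" by auto
  qed (simp add: dist_inf_def)
  assume h: "h \<in> bounded_measurable"
  have "\<bar>f s - h s\<bar> \<le> dist_inf f g + dist_inf g h" for s
    using up[OF fg, of s] up[OF fg(2) h, of s] fg h unfolding dist_inf_def by simp
  then show "dist_inf f h \<le> dist_inf f g + dist_inf g h"
    using fg h by (auto simp: dist_inf_def[of f h] intro!: cSUP_least)
qed

context discounted_dp
begin

lemma transition_kernel:
  "(\<lambda>(s, a). p s a) \<in> state_action_space A \<rightarrow>\<^sub>M prob_algebra borel"
proof (intro measurable_prob_algebraI measurable_subprob_algebra)
  have A: "snd x \<in> A" if "x \<in> space (state_action_space A)" for x :: "'s \<times> (real^'k)"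
    using that by (auto simp: state_action_space_def space_pair_measure space_restrict_space)
  fix B :: "'s set"
  assume "B \<in> sets borel"
  from transition_measurable[OF this]
  have "(\<lambda>x. ennreal (case x of (s, a) \<Rightarrow> measure (p s a) B))
      \<in> borel_measurable (state_action_space A)"
    unfolding state_action_space_def by measurable
  then show "(\<lambda>x. emeasure (case x of (s, a) \<Rightarrow> p s a) B) \<in> borel_measurable (state_action_space A)"
    by (rule measurable_cong[THEN iffD1, rotated])
      (auto simp: finite_measure.emeasure_eq_measure dest!: A
        intro!: prob_space.finite_measure transition_prob
          finite_measure.emeasure_eq_measure[symmetric])
qed (auto simp: state_action_space_def space_pair_measure space_restrict_space
    intro!: transition_prob prob_space_imp_subprob_space transition_sets)

lemma Ionescu_Tulcea_step_kernel:
  assumes \<sigma>: "\<sigma> \<in> strategies A \<Gamma>"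
  shows "Ionescu_Tulcea (step_kernel A p \<sigma> s) (\<lambda>_. state_action_space A)"
proof -
  have "step_kernel A p \<sigma> s t \<in> PiM {0..<t} (\<lambda>_. state_action_space A) \<rightarrow>\<^sub>M
      prob_algebra (state_action_space A)" for t
  proof -
    let ?H = "PiM {0..<t} (\<lambda>_. state_action_space A) :: (nat \<Rightarrow> 's \<times> (real^'k)) measure"
    have meas: "\<sigma> t \<in> ?H \<Otimes>\<^sub>M borel \<rightarrow>\<^sub>M restrict_space borel A"
      using \<sigma> by (auto simp: strategies_def history_space_def)
    have 1: "(\<lambda>(\<omega>, s'). (s', \<sigma> t (\<omega>, s'))) \<in> ?H \<Otimes>\<^sub>M borel \<rightarrow>\<^sub>M state_action_space A"
      using meas[unfolded state_action_space_def, measurable]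
      unfolding state_action_space_def by measurable
    have 2: "(\<lambda>\<omega>. case t of 0 \<Rightarrow> return borel s | Suc n \<Rightarrow> p (fst (\<omega> n)) (snd (\<omega> n)))
        \<in> ?H \<rightarrow>\<^sub>M prob_algebra borel"
    proof (cases t)
      case 0
      then show ?thesis by (auto simp: space_prob_algebra intro!: prob_space_return)
    next
      case (Suc n)
      have "(\<lambda>\<omega>. \<omega> n) \<in> ?H \<rightarrow>\<^sub>M state_action_space A"
        using Suc by (intro measurable_component_singleton) auto
      from measurable_compose[OF this transition_kernel] show ?thesis
        by (simp add: Suc split_beta)
    qed
    show ?thesis
      unfolding step_kernel_def[abs_def] by (rule measurable_distr_prob_space2[OF 2 1])
  qed
  note kernel = this
  have "prob_space (step_kernel A p \<sigma> s t \<omega>)"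
    if "\<omega> \<in> space (PiM {0..<t} (\<lambda>_. state_action_space A))" for t \<omega>
    using measurable_space[OF kernel that] by (simp add: space_prob_algebra)
  then show ?thesis
    using kernel by (intro Ionescu_Tulcea.intro measurable_prob_algebraD)
qed

lemma stationary_strategy_in_strategies:
  assumes "l \<in> stationary_policies A \<Gamma>"
  shows "stationary_strategy l \<in> strategies A \<Gamma>"
proof -
  have [measurable]: "l \<in> borel \<rightarrow>\<^sub>M restrict_space borel A"
    using assms by (simp add: stationary_policies_def)
  show ?thesis
    using assms
    by (auto simp: strategies_def stationary_strategy_def history_space_def stationary_policies_def)
qed

end

end

theory Submission
  imports Defs
begin

text \<open>
  The Bellman operator is a \<open>\<beta>\<close>-contraction, so it has a fixed point \<open>f\<close> in \<open>D\<close>. Telescoping the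
  expected discounted values of \<open>f\<close> along the process shows that \<open>V\<^sub>\<sigma>(s) - f(s)\<close> is the sum of the
  discounted expected advantages \<open>Q(s\<^sub>t, a\<^sub>t, f) - f(s\<^sub>t)\<close>. These are nonpositive for every strategy
  and vanish for a stationary policy in \<open>\<Lambda>\<^sub>f\<close>, hence \<open>V = f\<close>.
\<close>

section \<open>One-coordinate marginals of the Ionescu-Tulcea measure\<close>

context Ionescu_Tulcea
begin

text \<open>The limit measure is known only through its finite marginals \<open>CI J\<close>, so the
  coordinate map is factored through the product over \<open>{n}\<close>. Since
  \<open>CI {n}\<close> is itself an image of a finite stage \<open>C\<close>, the infinite product
  disappears.\<close>

lemma distr_lim_component:
  "distr PF.lim (M n) (\<lambda>\<omega>. \<omega> n) = distr (C 0 (Suc n) (\<lambda>_. undefined)) (M n) (\<lambda>\<omega>. \<omega> n)"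
proof -
  \<comment> \<open>\<open>up_to\<close> is an exclusive bound: coordinate \<open>n\<close> first
    exists at stage \<open>Suc n\<close>.\<close>
  have up_to: "up_to {n} = Suc n"
    unfolding up_to_def by (rule Least_equality) (auto simp: Suc_le_eq not_less_eq_eq)
  have sets_C': "sets (C 0 (Suc n) (\<lambda>_. undefined)) = sets (PiM {0..<Suc n} M)"
    by (subst sets_C) simp_all
  have restrict: "(\<lambda>\<omega>. restrict \<omega> {n}) \<in> PF.lim \<rightarrow>\<^sub>M PiM {n} M"
    "(\<lambda>\<omega>. restrict \<omega> {n}) \<in> C 0 (Suc n) (\<lambda>_. undefined) \<rightarrow>\<^sub>M PiM {n} M"
    by (auto simp: measurable_cong_sets[OF PF.sets_lim refl] measurable_cong_sets[OF sets_C' refl]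
        simp del: C.simps intro!: measurable_restrict_subset)
  have component: "(\<lambda>\<omega>. \<omega> n) \<in> PiM {n} M \<rightarrow>\<^sub>M M n"
    by (rule measurable_component_singleton) simp
  have "distr PF.lim (M n) (\<lambda>\<omega>. \<omega> n)
      = distr (distr PF.lim (PiM {n} M) (\<lambda>\<omega>. restrict \<omega> {n})) (M n) (\<lambda>\<omega>. \<omega> n)"
    by (subst distr_distr[OF component restrict(1)]) (simp add: comp_def)
  also have "\<dots> = distr (CI {n}) (M n) (\<lambda>\<omega>. \<omega> n)"
    by (simp add: distr_lim)
  also have "\<dots> = distr (C 0 (Suc n) (\<lambda>_. undefined)) (M n) (\<lambda>\<omega>. \<omega> n)"
    unfolding CI_def up_to
    by (subst distr_distr[OF component restrict(2)]) (simp add: comp_def)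
  finally show ?thesis .
qed

text \<open>Stage \<open>Suc n\<close> is stage \<open>n\<close> bound to \<open>eP n\<close>, and
  \<open>eP n\<close> appends a draw from \<open>P n\<close> by \<open>fun_upd\<close>. Reading
  coordinate \<open>n\<close> undoes the update and leaves the draw itself.\<close>

lemma distr_C_last:
  "distr (C 0 (Suc n) (\<lambda>_. undefined)) (M n) (\<lambda>\<omega>. \<omega> n) = C 0 n (\<lambda>_. undefined) \<bind> P n"
proof -
  have space_C': "space (C 0 n (\<lambda>_. undefined)) = space (PiM {0..<n} M)"
    by (subst space_C) simp_all
  have sets_C': "sets (C 0 n (\<lambda>_. undefined)) = sets (PiM {0..<n} M)"
    by (subst sets_C) simp_all
  have component: "(\<lambda>\<omega>. \<omega> n) \<in> PiM {0..<Suc n} M \<rightarrow>\<^sub>M M n"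
    by (rule measurable_component_singleton) simp
  have eP: "eP n \<in> C 0 n (\<lambda>_. undefined) \<rightarrow>\<^sub>M subprob_algebra (PiM {0..<Suc n} M)"
    using measurable_eP by (simp add: measurable_cong_sets[OF sets_C' refl])
  have "distr (C 0 (Suc n) (\<lambda>_. undefined)) (M n) (\<lambda>\<omega>. \<omega> n)
      = C 0 n (\<lambda>_. undefined) \<bind> (\<lambda>\<omega>. distr (eP n \<omega>) (M n) (\<lambda>\<omega>. \<omega> n))"
    using space_C' by (simp add: distr_bind[OF eP _ component] prob_space.not_empty[OF prob_space_C])
  also have "\<dots> = C 0 n (\<lambda>_. undefined) \<bind> P n"
  proof (rule bind_cong_All, intro ballI)
    fix \<omega> assume "\<omega> \<in> space (C 0 n (\<lambda>_. undefined))"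
    then have \<omega>: "\<omega> \<in> space (PiM {0..<n} M)" by (simp add: space_C')
    have upd: "fun_upd \<omega> n \<in> P n \<omega> \<rightarrow>\<^sub>M PiM {0..<Suc n} M"
      using \<omega> by (intro measurable_fun_upd[where J="{0..<n}"])
        (auto simp: measurable_cong_sets[OF sets_P refl])
    have "distr (eP n \<omega>) (M n) (\<lambda>\<omega>. \<omega> n) = distr (P n \<omega>) (M n) (\<lambda>x. x)"
      unfolding eP_def by (subst distr_distr[OF component upd]) (simp add: comp_def)
    also have "\<dots> = P n \<omega>"
      by (rule distr_id2) (simp add: sets_P[OF \<omega>])
    finally show "distr (eP n \<omega>) (M n) (\<lambda>\<omega>. \<omega> n) = P n \<omega>" .
  qed
  finally show ?thesis .
qed

text \<open>An image measure has the same total mass as its source, so it is enough that coordinate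
  0 is distributed according to a probability measure.\<close>

lemma prob_space_lim: "prob_space PF.lim"
proof -
  have "prob_space (C 0 (Suc 0) (\<lambda>_. undefined))"
    by (rule prob_space_C) simp
  then have "prob_space (distr (C 0 (Suc 0) (\<lambda>_. undefined)) (M 0) (\<lambda>\<omega>. \<omega> 0))"
    by (rule prob_space.prob_space_distr)
      (subst measurable_cong_sets[OF sets_C refl], auto intro!: measurable_component_singleton)
  then have "prob_space (distr PF.lim (M 0) (\<lambda>\<omega>. \<omega> 0))"
    by (simp only: distr_lim_component)
  then show ?thesis
    by (rule prob_space_distrD[rotated])
      (auto simp: measurable_cong_sets[OF PF.sets_lim refl] intro!: measurable_component_singleton)
qed

text \<open>The first form keeps coordinate \<open>n\<close> inside stage \<open>Suc n\<close>; the
  second integrates it out by the kernel over stage \<open>n\<close>. The first at time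
  \<open>t\<close> and the second at time \<open>Suc t\<close> therefore share the same outer
  measure, which is what relates consecutive times.\<close>

lemma integral_lim_component:
  fixes f :: "'a \<Rightarrow> real"
  assumes f: "f \<in> borel_measurable (M n)" and bound: "\<And>x. x \<in> space (M n) \<Longrightarrow> \<bar>f x\<bar> \<le> B"
  shows "(\<integral>\<omega>. f (\<omega> n) \<partial>PF.lim) = (\<integral>\<omega>. f (\<omega> n) \<partial>C 0 (Suc n) (\<lambda>_. undefined))"
    and "(\<integral>\<omega>. f (\<omega> n) \<partial>PF.lim) = (\<integral>\<omega>. (\<integral>x. f x \<partial>P n \<omega>) \<partial>C 0 n (\<lambda>_. undefined))"
proof -
  have sets_C': "sets (C 0 m (\<lambda>_. undefined)) = sets (PiM {0..<m} M)" for m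
    by (subst sets_C) simp_all
  have P: "P n \<in> C 0 n (\<lambda>_. undefined) \<rightarrow>\<^sub>M subprob_algebra (M n)"
    by (subst measurable_cong_sets[OF sets_C' refl]) (rule P)
  have C: "prob_space (C 0 n (\<lambda>_. undefined))"
    by (rule prob_space_C) simp
  have "(\<integral>\<omega>. f (\<omega> n) \<partial>PF.lim) = integral\<^sup>L (distr PF.lim (M n) (\<lambda>\<omega>. \<omega> n)) f"
    by (rule integral_distr[symmetric, OF _ f])
      (auto simp: measurable_cong_sets[OF PF.sets_lim refl] intro!: measurable_component_singleton)
  then have lim: "(\<integral>\<omega>. f (\<omega> n) \<partial>PF.lim) =
      integral\<^sup>L (distr (C 0 (Suc n) (\<lambda>_. undefined)) (M n) (\<lambda>\<omega>. \<omega> n)) f"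
    by (simp only: distr_lim_component)
  also have "\<dots> = (\<integral>\<omega>. f (\<omega> n) \<partial>C 0 (Suc n) (\<lambda>_. undefined))"
    by (rule integral_distr[OF _ f])
      (subst measurable_cong_sets[OF sets_C' refl], auto intro!: measurable_component_singleton)
  finally show "(\<integral>\<omega>. f (\<omega> n) \<partial>PF.lim) = (\<integral>\<omega>. f (\<omega> n) \<partial>C 0 (Suc n) (\<lambda>_. undefined))" .
  show "(\<integral>\<omega>. f (\<omega> n) \<partial>PF.lim) = (\<integral>\<omega>. (\<integral>x. f x \<partial>P n \<omega>) \<partial>C 0 n (\<lambda>_. undefined))"
    unfolding lim distr_C_last
  proof (rule integral_bind[OF f bound P])
    show "finite_measure (C 0 n (\<lambda>_. undefined))"
      by (rule prob_space.finite_measure[OF C])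
    show "AE \<omega> in C 0 n (\<lambda>_. undefined). emeasure (P n \<omega>) (space (P n \<omega>)) \<le> ennreal 1"
      using subprob_space.emeasure_space_le_1[OF subprob_space_kernel[OF P]] by simp
  qed
qed

end

section \<open>Expectations of functions of a single state-action pair\<close>

context discounted_dp
begin

lemma in_space_state_action_space: "x \<in> space (state_action_space A) \<longleftrightarrow> snd x \<in> A"
  by (cases x) (auto simp: state_action_space_def space_pair_measure space_restrict_space)

lemma fst_measurable_state_action_space: "fst \<in> state_action_space A \<rightarrow>\<^sub>M borel"
  unfolding state_action_space_def by measurable

lemma reward_measurable_state_action_space:
  "(\<lambda>x. r (fst x) (snd x)) \<in> borel_measurable (state_action_space A)"
  using payoff_measurable by (simp add: state_action_space_def split_beta)

lemma next_expectation_measurable: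
  fixes f :: "'s \<Rightarrow> real"
  assumes "f \<in> borel_measurable borel"
  shows "(\<lambda>x. \<integral>s'. f s' \<partial>p (fst x) (snd x)) \<in> borel_measurable (state_action_space A)"
  using measurable_compose[OF measurable_prob_algebraD[OF transition_kernel]
      integral_measurable_subprob_algebra[OF assms]]
  by (simp add: split_beta)

lemma Q_value_measurable:
  assumes "f \<in> borel_measurable borel"
  shows "(\<lambda>x. Q_value p r \<beta> (fst x) (snd x) f) \<in> borel_measurable (state_action_space A)"
  unfolding Q_value_def
  using reward_measurable_state_action_space next_expectation_measurable[OF assms] by simp

lemma integrable_transition:
  fixes f :: "'s \<Rightarrow> real"
  assumes "a \<in> A" "f \<in> borel_measurable borel" "\<And>s. \<bar>f s\<bar> \<le> B"
  shows "integrable (p s a) f"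
proof -
  interpret prob_space "p s a" using assms(1) by (rule transition_prob)
  show ?thesis
    using assms
    by (intro integrable_const_bound[where B=B])
      (auto simp: measurable_cong_sets[OF transition_sets refl])
qed

lemma abs_integral_transition_le:
  fixes f :: "'s \<Rightarrow> real"
  assumes "a \<in> A" "\<And>s. \<bar>f s\<bar> \<le> B"
  shows "\<bar>\<integral>s'. f s' \<partial>p s a\<bar> \<le> B"
proof -
  interpret prob_space "p s a" using assms(1) by (rule transition_prob)
  show ?thesis
  proof (cases "integrable (p s a) f")
    case True
    then have "(\<integral>s'. \<bar>f s'\<bar> \<partial>p s a) \<le> B"
      using assms(2) by (intro integral_le_const) auto
    then show ?thesis
      using integral_abs_bound[of "p s a" f] by linarith
  next
    \<comment> \<open>A Bochner integral without integrability is 0 by convention, and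
      \<open>B\<close> is nonnegative because it bounds an absolute value.\<close>
    case False
    then show ?thesis
      using order_trans[OF abs_ge_zero assms(2)] by (simp add: not_integrable_integral_eq)
  qed
qed

text \<open>Given the past, only the new state is random, since the action is a function of the
  extended history. Hence \<open>step_kernel\<close> is an image of the state law, and the change of
  variables leaves an integral over states alone.\<close>

lemma path_integral_eq:
  fixes g :: "'s \<times> (real^'k) \<Rightarrow> real"
  assumes \<sigma>: "\<sigma> \<in> strategies A \<Gamma>"
    and g: "g \<in> borel_measurable (state_action_space A)"
    and bound: "\<And>x. snd x \<in> A \<Longrightarrow> \<bar>g x\<bar> \<le> B"
  shows "(\<integral>\<omega>. g (\<omega> t) \<partial>path_measure A p \<sigma> s) =
    (\<integral>\<omega>. (\<integral>s'. g (s', \<sigma> t (\<omega>, s'))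
          \<partial>(case t of 0 \<Rightarrow> return borel s | Suc n \<Rightarrow> p (fst (\<omega> n)) (snd (\<omega> n))))
      \<partial>Ionescu_Tulcea.C (step_kernel A p \<sigma> s) (\<lambda>_. state_action_space A) 0 t (\<lambda>_. undefined))"
proof -
  interpret IT: Ionescu_Tulcea "step_kernel A p \<sigma> s" "\<lambda>_. state_action_space A"
    using \<sigma> by (rule Ionescu_Tulcea_step_kernel)
  have "(\<integral>\<omega>. g (\<omega> t) \<partial>path_measure A p \<sigma> s)
      = (\<integral>\<omega>. (\<integral>x. g x \<partial>step_kernel A p \<sigma> s t \<omega>) \<partial>IT.C 0 t (\<lambda>_. undefined))"
    unfolding path_measure_def
    using g bound by (intro IT.integral_lim_component(2)[where B=B])
      (auto simp: in_space_state_action_space)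
  also have "\<dots> = (\<integral>\<omega>. (\<integral>s'. g (s', \<sigma> t (\<omega>, s'))
          \<partial>(case t of 0 \<Rightarrow> return borel s | Suc n \<Rightarrow> p (fst (\<omega> n)) (snd (\<omega> n))))
      \<partial>IT.C 0 t (\<lambda>_. undefined))"
  proof (rule Bochner_Integration.integral_cong[OF refl])
    fix \<omega> assume "\<omega> \<in> space (IT.C 0 t (\<lambda>_. undefined))"
    then have \<omega>: "\<omega> \<in> space (PiM {0..<t} (\<lambda>_. state_action_space A))"
      by (subst (asm) IT.space_C) simp_all
    let ?K = "case t of 0 \<Rightarrow> return borel s | Suc n \<Rightarrow> p (fst (\<omega> n)) (snd (\<omega> n))"
    \<comment> \<open>The sigma-algebra of \<open>p\<close> is prescribed only for actions in
      \<open>A\<close>; the last recorded action lies there because \<omega> belongs to the product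
      space.\<close>
    have K: "sets ?K = sets borel"
    proof (cases t)
      case (Suc n)
      have "\<omega> n \<in> space (state_action_space A)"
        using \<omega> Suc by (auto simp: space_PiM PiE_iff)
      then show ?thesis
        by (simp add: Suc in_space_state_action_space transition_sets)
    qed simp
    have "\<sigma> t \<in> PiM {0..<t} (\<lambda>_. state_action_space A) \<Otimes>\<^sub>M borel \<rightarrow>\<^sub>M restrict_space borel A"
      using \<sigma> by (auto simp: strategies_def history_space_def)
    then have "(\<lambda>s'. \<sigma> t (\<omega>, s')) \<in> borel \<rightarrow>\<^sub>M restrict_space borel A"
      using \<omega> by (auto intro!: measurable_compose[OF measurable_Pair1'])
    then have "(\<lambda>s'. (s', \<sigma> t (\<omega>, s'))) \<in> ?K \<rightarrow>\<^sub>M state_action_space A"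
      unfolding measurable_cong_sets[OF K refl] state_action_space_def by simp
    then show "(\<integral>x. g x \<partial>step_kernel A p \<sigma> s t \<omega>) = (\<integral>s'. g (s', \<sigma> t (\<omega>, s')) \<partial>?K)"
      unfolding step_kernel_def by (rule integral_distr[OF _ g])
  qed
  finally show ?thesis .
qed

text \<open>The sign is required at the pairs that \<sigma> produces at histories, where feasibility
  of \<sigma> is available pointwise. The graph of \<Gamma> is not assumed measurable, so this form
  avoids any event describing feasible pairs.\<close>

lemma path_integral_nonpos:
  fixes g :: "'s \<times> (real^'k) \<Rightarrow> real"
  assumes \<sigma>: "\<sigma> \<in> strategies A \<Gamma>"
    and g: "g \<in> borel_measurable (state_action_space A)"
    and bound: "\<And>x. snd x \<in> A \<Longrightarrow> \<bar>g x\<bar> \<le> B"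
    and nonpos: "\<And>h. h \<in> space (history_space A t) \<Longrightarrow> g (snd h, \<sigma> t h) \<le> 0"
  shows "(\<integral>\<omega>. g (\<omega> t) \<partial>path_measure A p \<sigma> s) \<le> 0"
proof -
  interpret IT: Ionescu_Tulcea "step_kernel A p \<sigma> s" "\<lambda>_. state_action_space A"
    using \<sigma> by (rule Ionescu_Tulcea_step_kernel)
  have neg: "0 \<le> - g (s', \<sigma> t (\<omega>, s'))" if "\<omega> \<in> space (IT.C 0 t (\<lambda>_. undefined))" for \<omega> s'
  proof -
    have "\<omega> \<in> space (PiM {0..<t} (\<lambda>_. state_action_space A))"
      using that by (subst (asm) IT.space_C) simp_all
    then show ?thesis
      using nonpos[of "(\<omega>, s')"] by (simp add: history_space_def space_pair_measure)
  qed
  have "0 \<le> (\<integral>\<omega>. (\<integral>s'. - g (s', \<sigma> t (\<omega>, s'))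
          \<partial>(case t of 0 \<Rightarrow> return borel s | Suc n \<Rightarrow> p (fst (\<omega> n)) (snd (\<omega> n))))
      \<partial>IT.C 0 t (\<lambda>_. undefined))"
    by (intro Bochner_Integration.integral_nonneg neg)
  then show ?thesis
    by (simp add: path_integral_eq[OF \<sigma> g bound])
qed

lemma path_integral_eq_0:
  fixes g :: "'s \<times> (real^'k) \<Rightarrow> real"
  assumes \<sigma>: "\<sigma> \<in> strategies A \<Gamma>"
    and g: "g \<in> borel_measurable (state_action_space A)"
    and bound: "\<And>x. snd x \<in> A \<Longrightarrow> \<bar>g x\<bar> \<le> B"
    and zero: "\<And>h. h \<in> space (history_space A t) \<Longrightarrow> g (snd h, \<sigma> t h) = 0"
  shows "(\<integral>\<omega>. g (\<omega> t) \<partial>path_measure A p \<sigma> s) = 0"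
  using path_integral_nonpos[OF \<sigma> g bound, of t s]
    path_integral_nonpos[OF \<sigma>, of "\<lambda>x. - g x" B t s] g bound zero
  by simp

text \<open>At time 0 the state law is the point mass at \<open>s\<close>, and what remains is a
  constant integrated over the probability measure of the empty past.\<close>

lemma path_integral_initial:
  fixes f :: "'s \<Rightarrow> real"
  assumes \<sigma>: "\<sigma> \<in> strategies A \<Gamma>"
    and f: "f \<in> borel_measurable borel" and bound: "\<And>s. \<bar>f s\<bar> \<le> B"
  shows "(\<integral>\<omega>. f (fst (\<omega> 0)) \<partial>path_measure A p \<sigma> s) = f s"
proof -
  interpret IT: Ionescu_Tulcea "step_kernel A p \<sigma> s" "\<lambda>_. state_action_space A"
    using \<sigma> by (rule Ionescu_Tulcea_step_kernel)
  interpret C: prob_space "IT.C 0 0 (\<lambda>_. undefined)"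
    by (rule IT.prob_space_C) simp
  show ?thesis
    using path_integral_eq[OF \<sigma>, of "\<lambda>x. f (fst x)" B s 0]
      measurable_compose[OF fst_measurable_state_action_space f] bound f
    by (simp add: integral_return C.prob_space del: IT.C.simps)
qed

text \<open>The Markov step behind the telescoping. Both sides reduce to the same integral over
  stage \<open>Suc t\<close>: the right one by reading the pair at time \<open>t\<close>, the left
  one by integrating out the state at time \<open>Suc t\<close>.\<close>

lemma path_integral_next:
  fixes f :: "'s \<Rightarrow> real"
  assumes \<sigma>: "\<sigma> \<in> strategies A \<Gamma>"
    and f: "f \<in> borel_measurable borel" and bound: "\<And>s. \<bar>f s\<bar> \<le> B"
  shows "(\<integral>\<omega>. f (fst (\<omega> (Suc t))) \<partial>path_measure A p \<sigma> s) =
    (\<integral>\<omega>. (\<integral>s'. f s' \<partial>p (fst (\<omega> t)) (snd (\<omega> t))) \<partial>path_measure A p \<sigma> s)"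
proof -
  interpret IT: Ionescu_Tulcea "step_kernel A p \<sigma> s" "\<lambda>_. state_action_space A"
    using \<sigma> by (rule Ionescu_Tulcea_step_kernel)
  have "(\<integral>\<omega>. (\<integral>s'. f s' \<partial>p (fst (\<omega> t)) (snd (\<omega> t))) \<partial>path_measure A p \<sigma> s)
      = (\<integral>\<omega>. (\<integral>s'. f s' \<partial>p (fst (\<omega> t)) (snd (\<omega> t))) \<partial>IT.C 0 (Suc t) (\<lambda>_. undefined))"
    unfolding path_measure_def
    by (rule IT.integral_lim_component(1)[OF next_expectation_measurable[OF f], where B=B])
      (auto simp: in_space_state_action_space intro!: abs_integral_transition_le bound)
  also have "\<dots> = (\<integral>\<omega>. f (fst (\<omega> (Suc t))) \<partial>path_measure A p \<sigma> s)"
    using path_integral_eq[OF \<sigma>, of "\<lambda>x. f (fst x)" B s "Suc t"]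
      measurable_compose[OF fst_measurable_state_action_space f] bound
    by (simp del: IT.C.simps)
  finally show ?thesis by simp
qed

end

section \<open>The Bellman operator of a model with bounded payoffs\<close>

locale bounded_discounted_dp = discounted_dp A \<Gamma> p r \<beta>
  for A :: "(real^'k) set"
    and \<Gamma> :: "'s::polish_space \<Rightarrow> (real^'k) set"
    and p :: "'s \<Rightarrow> (real^'k) \<Rightarrow> 's measure"
    and r :: "'s \<Rightarrow> (real^'k) \<Rightarrow> real"
    and \<beta> :: real +
  fixes R :: real
  assumes payoff_bound: "\<And>s a. a \<in> A \<Longrightarrow> \<bar>r s a\<bar> \<le> R"
    and feasible_nonempty: "\<And>s. \<Gamma> s \<noteq> {}"
begin

lemma abs_Q_value_le:
  assumes "a \<in> A" "\<And>s. \<bar>f s\<bar> \<le> B"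
  shows "\<bar>Q_value p r \<beta> s a f\<bar> \<le> R + \<beta> * B"
proof -
  have "\<bar>\<beta> * (\<integral>s'. f s' \<partial>p s a)\<bar> \<le> \<beta> * B"
    using abs_integral_transition_le[OF assms] discount_pos by (simp add: abs_mult)
  then show ?thesis
    using payoff_bound[OF assms(1), of s] unfolding Q_value_def by linarith
qed

text \<open>A real \<open>SUP\<close> is a least upper bound only over a nonempty set that is
  bounded above; this supplies the boundedness for \<open>bellman\<close>.\<close>

lemma bdd_above_Q_value:
  assumes "f \<in> bounded_measurable"
  shows "bdd_above ((\<lambda>a. Q_value p r \<beta> s a f) ` \<Gamma> s)"
proof -
  from assms obtain B where "\<And>s. \<bar>f s\<bar> \<le> B"
    unfolding bounded_measurable_def bounded_iff by auto
  then show ?thesis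
    using abs_Q_value_le[of _ f B s] feasible_subset[of s]
    by (intro bdd_aboveI2[where M="R + \<beta> * B"]) (meson abs_le_D1 subsetD)
qed

lemma Q_value_le_bellman:
  assumes "f \<in> bounded_measurable" "a \<in> \<Gamma> s"
  shows "Q_value p r \<beta> s a f \<le> bellman \<Gamma> p r \<beta> f s"
  unfolding bellman_def by (rule cSUP_upper[OF assms(2) bdd_above_Q_value[OF assms(1)]])

text \<open>Averaging against a probability measure moves by at most \<open>d\<close>, so each
  \<open>Q_value\<close> moves by at most \<open>\<beta> * d\<close>, uniformly in the action, and
  the bound passes to the supremum. Exchanging \<open>f\<close> and \<open>g\<close> later gives the
  two-sided estimate.\<close>

lemma bellman_le_add:
  assumes f: "f \<in> bounded_measurable" and g: "g \<in> bounded_measurable"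
    and le: "\<And>s. \<bar>f s - g s\<bar> \<le> d"
  shows "bellman \<Gamma> p r \<beta> f s \<le> bellman \<Gamma> p r \<beta> g s + \<beta> * d"
proof -
  have "Q_value p r \<beta> s a f \<le> bellman \<Gamma> p r \<beta> g s + \<beta> * d" if a: "a \<in> \<Gamma> s" for a
  proof -
    have A: "a \<in> A" using a feasible_subset by blast
    have int: "integrable (p s a) h" if "h \<in> bounded_measurable" for h
    proof -
      from that obtain B where "h \<in> borel_measurable borel" "\<And>s. \<bar>h s\<bar> \<le> B"
        unfolding bounded_measurable_def bounded_iff by auto
      then show ?thesis by (rule integrable_transition[OF A])
    qed
    have "(\<integral>s'. f s' \<partial>p s a) - (\<integral>s'. g s' \<partial>p s a) = (\<integral>s'. f s' - g s' \<partial>p s a)"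
      using int f g by simp
    also have "\<dots> \<le> d"
      using abs_integral_transition_le[where f="\<lambda>s'. f s' - g s'", OF A le, of s] by linarith
    finally have "\<beta> * ((\<integral>s'. f s' \<partial>p s a) - (\<integral>s'. g s' \<partial>p s a)) \<le> \<beta> * d"
      using discount_pos by simp
    then have "Q_value p r \<beta> s a f \<le> Q_value p r \<beta> s a g + \<beta> * d"
      by (simp add: Q_value_def algebra_simps)
    then show ?thesis
      using Q_value_le_bellman[OF g a] by linarith
  qed
  then show ?thesis
    unfolding bellman_def[of _ _ _ _ f] by (intro cSUP_least feasible_nonempty)
qed

text \<open>A supremum over uncountably many actions can destroy measurability, so it is assumed for
  both images; this lets \<open>dist_inf\<close> unfold to the genuine supremum instead of its dummy
  value.\<close>

lemma bellman_contraction: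
  assumes f: "f \<in> bounded_measurable" and g: "g \<in> bounded_measurable"
    and Tf: "bellman \<Gamma> p r \<beta> f \<in> bounded_measurable" and Tg: "bellman \<Gamma> p r \<beta> g \<in> bounded_measurable"
  shows "dist_inf (bellman \<Gamma> p r \<beta> f) (bellman \<Gamma> p r \<beta> g) \<le> \<beta> * dist_inf f g"
proof -
  have le: "\<bar>f s - g s\<bar> \<le> dist_inf f g" "\<bar>g s - f s\<bar> \<le> dist_inf f g" for s
    using cSUP_upper[OF UNIV_I bdd_above_dist_inf[OF f g], of s] f g
    by (simp_all add: dist_inf_def abs_minus_commute)
  have "\<bar>bellman \<Gamma> p r \<beta> f s - bellman \<Gamma> p r \<beta> g s\<bar> \<le> \<beta> * dist_inf f g" for s
    using bellman_le_add[OF f g le(1), of s] bellman_le_add[OF g f le(2), of s] by linarith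
  then show ?thesis
    using Tf Tg by (subst dist_inf_def) (auto intro!: cSUP_least)
qed

text \<open>Banach's theorem on the subspace \<open>D\<close>. Only existence is extracted:
  uniqueness comes from identifying every fixed point in \<open>D\<close> with the value
  function.\<close>

lemma ex_bellman_fixed_point:
  assumes D: "D \<subseteq> bounded_measurable" "D \<noteq> {}" "Metric_space.mcomplete D dist_inf"
    and T: "\<And>f. f \<in> D \<Longrightarrow> bellman \<Gamma> p r \<beta> f \<in> D"
  shows "\<exists>f\<in>D. bellman \<Gamma> p r \<beta> f = f"
proof -
  interpret Metric_space D dist_inf
    by (rule Metric_space.subspace[OF Metric_space_bounded_measurable D(1)])
  obtain f where "f \<in> D" "bellman \<Gamma> p r \<beta> f = f"
  proof (rule Banach_fixedpoint_thm[OF D(3,2) _ discount_less_1])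
    show "bellman \<Gamma> p r \<beta> \<in> D \<rightarrow> D" using T by auto
    show "dist_inf (bellman \<Gamma> p r \<beta> f) (bellman \<Gamma> p r \<beta> g) \<le> \<beta> * dist_inf f g"
      if "f \<in> D" "g \<in> D" for f g
      using that T D(1) by (intro bellman_contraction) auto
  qed
  then show ?thesis by auto
qed

section \<open>Values of strategies compared with a fixed point\<close>

text \<open>Expected rewards sum to the value of \<sigma>, and the remaining terms in
  \<open>f\<close> telescope. The identity involves no Bellman equation; that equation only decides
  the sign of the summands.\<close>

lemma strategy_value_difference:
  fixes f :: "'s \<Rightarrow> real"
  assumes \<sigma>: "\<sigma> \<in> strategies A \<Gamma>" and f: "f \<in> bounded_measurable"
  shows "(\<lambda>t. \<beta> ^ t * (\<integral>\<omega>. Q_value p r \<beta> (fst (\<omega> t)) (snd (\<omega> t)) f - f (fst (\<omega> t))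
      \<partial>path_measure A p \<sigma> s)) sums (strategy_value A p r \<beta> \<sigma> s - f s)"
proof -
  let ?P = "path_measure A p \<sigma> s"
  define rew where "rew t = (\<integral>\<omega>. r (fst (\<omega> t)) (snd (\<omega> t)) \<partial>?P)" for t
  define val where "val t = (\<integral>\<omega>. f (fst (\<omega> t)) \<partial>?P)" for t
  interpret IT: Ionescu_Tulcea "step_kernel A p \<sigma> s" "\<lambda>_. state_action_space A"
    using \<sigma> by (rule Ionescu_Tulcea_step_kernel)
  interpret P: prob_space ?P
    unfolding path_measure_def by (rule IT.prob_space_lim)
  from f obtain B where f_meas: "f \<in> borel_measurable borel" and B: "\<And>s. \<bar>f s\<bar> \<le> B"
    unfolding bounded_measurable_def bounded_iff by auto
  have sets_P: "sets ?P = sets (PiM UNIV (\<lambda>_. state_action_space A))"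
    by (simp add: path_measure_def)
  \<comment> \<open>Every path in the underlying space has all its actions in \<open>A\<close>, so
    the payoff bound holds surely and not just almost surely.\<close>
  have in_A: "snd (\<omega> t) \<in> A" if "\<omega> \<in> space ?P" for \<omega> t
    using that by (auto simp: path_measure_def space_PiM PiE_iff in_space_state_action_space)
  have component: "(\<lambda>\<omega>. \<omega> t) \<in> ?P \<rightarrow>\<^sub>M state_action_space A" for t
    unfolding measurable_cong_sets[OF sets_P refl] by (rule measurable_component_singleton) simp
  have integrable: "integrable ?P (\<lambda>\<omega>. g (\<omega> t))"
    if "g \<in> borel_measurable (state_action_space A)" "\<And>x. snd x \<in> A \<Longrightarrow> \<bar>g x\<bar> \<le> c"
    for g :: "'s \<times> (real^'k) \<Rightarrow> real" and c t
    using that in_A by (intro P.integrable_const_bound[where B=c] measurable_compose[OF component]) auto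
  have int_r: "integrable ?P (\<lambda>\<omega>. r (fst (\<omega> t)) (snd (\<omega> t)))" for t
    using integrable[OF reward_measurable_state_action_space, of R] payoff_bound by simp
  have int_f: "integrable ?P (\<lambda>\<omega>. f (fst (\<omega> t)))" for t
    using integrable[OF measurable_compose[OF fst_measurable_state_action_space f_meas], of B] B
    by simp
  have int_next: "integrable ?P (\<lambda>\<omega>. \<integral>s'. f s' \<partial>p (fst (\<omega> t)) (snd (\<omega> t)))" for t
    using integrable[OF next_expectation_measurable[OF f_meas], of B]
      abs_integral_transition_le[of _ f B] B by simp
  have geom: "summable (\<lambda>t. \<beta> ^ t * c)" for c
    using discount_pos discount_less_1 by (intro summable_mult2 summable_geometric) simp
  have reward_le: "norm (\<beta> ^ t * r (fst (\<omega> t)) (snd (\<omega> t))) \<le> \<beta> ^ t * R"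
    if "\<omega> \<in> space ?P" for \<omega> t
    using payoff_bound[OF in_A[OF that]] discount_pos by (simp add: abs_mult mult_left_mono)
  \<comment> \<open>Sum and expectation are exchanged under the geometric majorant
    \<open>\<beta> ^ t * R\<close>.\<close>
  have "(\<lambda>t. \<integral>\<omega>. \<beta> ^ t * r (fst (\<omega> t)) (snd (\<omega> t)) \<partial>?P) sums strategy_value A p r \<beta> \<sigma> s"
    unfolding strategy_value_def
  proof (rule sums_integral)
    show "integrable ?P (\<lambda>\<omega>. \<beta> ^ t * r (fst (\<omega> t)) (snd (\<omega> t)))" for t
      using int_r by simp
    show "AE \<omega> in ?P. summable (\<lambda>t. norm (\<beta> ^ t * r (fst (\<omega> t)) (snd (\<omega> t))))"
      using reward_le by (intro AE_I2 summable_comparison_test'[OF geom[of R]]) simp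
    show "summable (\<lambda>t. \<integral>\<omega>. norm (\<beta> ^ t * r (fst (\<omega> t)) (snd (\<omega> t))) \<partial>?P)"
    proof (rule summable_comparison_test'[OF geom[of R]])
      fix t
      have "(\<integral>\<omega>. norm (\<beta> ^ t * r (fst (\<omega> t)) (snd (\<omega> t))) \<partial>?P) \<le> \<beta> ^ t * R"
        using reward_le int_r by (intro P.integral_le_const) auto
      then show "norm (\<integral>\<omega>. norm (\<beta> ^ t * r (fst (\<omega> t)) (snd (\<omega> t))) \<partial>?P) \<le> \<beta> ^ t * R"
        by simp
    qed
  qed
  then have rew: "(\<lambda>t. \<beta> ^ t * rew t) sums strategy_value A p r \<beta> \<sigma> s"
    by (simp add: rew_def)
  \<comment> \<open>The continuation term inside \<open>Q_value\<close> becomes the expectation of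
    \<open>f\<close> one period later.\<close>
  have adv: "(\<integral>\<omega>. Q_value p r \<beta> (fst (\<omega> t)) (snd (\<omega> t)) f - f (fst (\<omega> t)) \<partial>?P)
      = rew t + \<beta> * val (Suc t) - val t" for t
    unfolding Q_value_def rew_def val_def path_integral_next[OF \<sigma> f_meas B]
    using int_r int_f int_next by simp
  \<comment> \<open>Discounting kills the tail of the telescoping sum because \<open>f\<close> is
    bounded, so only the initial term survives.\<close>
  have "(\<lambda>t. \<beta> ^ t * val t) \<longlonglongrightarrow> 0"
  proof (rule Lim_null_comparison)
    have "\<bar>val t\<bar> \<le> B" for t
    proof -
      have "(\<integral>\<omega>. \<bar>f (fst (\<omega> t))\<bar> \<partial>?P) \<le> B"
        using int_f B by (intro P.integral_le_const) auto
      then show ?thesis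
        using integral_abs_bound[of ?P "\<lambda>\<omega>. f (fst (\<omega> t))"] unfolding val_def by linarith
    qed
    then show "\<forall>\<^sub>F t in sequentially. norm (\<beta> ^ t * val t) \<le> \<beta> ^ t * B"
      using discount_pos by (simp add: abs_mult mult_left_mono)
    show "(\<lambda>t. \<beta> ^ t * B) \<longlonglongrightarrow> 0"
      by (rule summable_LIMSEQ_zero[OF geom])
  qed
  then have "(\<lambda>t. \<beta> ^ Suc t * val (Suc t) - \<beta> ^ t * val t) sums (0 - \<beta> ^ 0 * val 0)"
    by (rule telescope_sums)
  moreover have "val 0 = f s"
    unfolding val_def by (rule path_integral_initial[OF \<sigma> f_meas B])
  ultimately have "(\<lambda>t. \<beta> ^ Suc t * val (Suc t) - \<beta> ^ t * val t) sums (- f s)"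
    by simp
  from sums_add[OF rew this]
  show ?thesis
    unfolding adv by (simp add: algebra_simps)
qed

lemma advantage_bound:
  assumes "\<And>s. \<bar>f s\<bar> \<le> B" "snd x \<in> A"
  shows "\<bar>Q_value p r \<beta> (fst x) (snd x) f - f (fst x)\<bar> \<le> R + \<beta> * B + B"
  using abs_Q_value_le[where f=f, OF assms(2,1), of "fst x"] assms(1)[of "fst x"] by linarith

lemma advantage_measurable:
  assumes "f \<in> borel_measurable borel"
  shows "(\<lambda>x. Q_value p r \<beta> (fst x) (snd x) f - f (fst x)) \<in> borel_measurable (state_action_space A)"
  using Q_value_measurable[OF assms] measurable_compose[OF fst_measurable_state_action_space assms]
  by simp

text \<open>A feasible action is one of the competitors in the supremum, whose value is
  \<open>f\<close> by the fixed-point equation; thus no summand of the difference series is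
  positive.\<close>

lemma strategy_value_le_fixed_point:
  assumes \<sigma>: "\<sigma> \<in> strategies A \<Gamma>" and f: "f \<in> bounded_measurable"
    and fixed: "bellman \<Gamma> p r \<beta> f = f"
  shows "strategy_value A p r \<beta> \<sigma> s \<le> f s"
proof -
  from f obtain B where f_meas: "f \<in> borel_measurable borel" and B: "\<And>s. \<bar>f s\<bar> \<le> B"
    unfolding bounded_measurable_def bounded_iff by auto
  have "(\<integral>\<omega>. Q_value p r \<beta> (fst (\<omega> t)) (snd (\<omega> t)) f - f (fst (\<omega> t)) \<partial>path_measure A p \<sigma> s) \<le> 0"
    for t
  proof (rule path_integral_nonpos[OF \<sigma> advantage_measurable[OF f_meas] advantage_bound[OF B]])
    fix h :: "(nat \<Rightarrow> 's \<times> (real^'k)) \<times> 's"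
    assume "h \<in> space (history_space A t)"
    then have "\<sigma> t h \<in> \<Gamma> (snd h)"
      using \<sigma> by (simp add: strategies_def)
    from Q_value_le_bellman[OF f this]
    show "Q_value p r \<beta> (fst (snd h, \<sigma> t h)) (snd (snd h, \<sigma> t h)) f - f (fst (snd h, \<sigma> t h)) \<le> 0"
      by (simp add: fixed)
  qed
  then have "strategy_value A p r \<beta> \<sigma> s - f s \<le> 0"
    using discount_pos
    by (intro sums_le[OF _ strategy_value_difference[OF \<sigma> f] sums_zero]) (simp add: mult_le_0_iff)
  then show ?thesis by simp
qed

text \<open>A maximizing policy turns the same inequality into an equality at every state, so all
  summands of the difference series vanish.\<close>

lemma stationary_value_eq_fixed_point:
  assumes l: "l \<in> argmax_policies A \<Gamma> p r \<beta> f" and f: "f \<in> bounded_measurable"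
    and fixed: "bellman \<Gamma> p r \<beta> f = f"
  shows "strategy_value A p r \<beta> (stationary_strategy l) s = f s"
proof -
  from f obtain B where f_meas: "f \<in> borel_measurable borel" and B: "\<And>s. \<bar>f s\<bar> \<le> B"
    unfolding bounded_measurable_def bounded_iff by auto
  have \<sigma>: "stationary_strategy l \<in> strategies A \<Gamma>"
    using l by (intro stationary_strategy_in_strategies) (simp add: argmax_policies_def)
  have "Q_value p r \<beta> s' (l s') f = f s'" for s'
    using l fun_cong[OF fixed, of s'] by (simp add: argmax_policies_def bellman_def)
  then have "(\<integral>\<omega>. Q_value p r \<beta> (fst (\<omega> t)) (snd (\<omega> t)) f - f (fst (\<omega> t))
      \<partial>path_measure A p (stationary_strategy l) s) = 0" for t
    by (intro path_integral_eq_0[OF \<sigma> advantage_measurable[OF f_meas] advantage_bound[OF B]])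
      (simp_all add: stationary_strategy_def)
  then have "(\<lambda>t. 0) sums (strategy_value A p r \<beta> (stationary_strategy l) s - f s)"
    using strategy_value_difference[OF \<sigma> f, of s] by simp
  then show ?thesis
    using sums_unique2[OF _ sums_zero] by force
qed

text \<open>The number \<open>f s\<close> bounds the values of all strategies and is attained by a
  stationary one, so the supremum is a maximum.\<close>

lemma value_function_eq_fixed_point:
  assumes "argmax_policies A \<Gamma> p r \<beta> f \<noteq> {}" "f \<in> bounded_measurable" "bellman \<Gamma> p r \<beta> f = f"
  shows "value_function A \<Gamma> p r \<beta> = f"
proof
  fix s
  from assms(1) obtain l where l: "l \<in> argmax_policies A \<Gamma> p r \<beta> f" by auto
  then have "stationary_strategy l \<in> strategies A \<Gamma>"
    by (intro stationary_strategy_in_strategies) (simp add: argmax_policies_def)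
  then show "value_function A \<Gamma> p r \<beta> s = f s"
    unfolding value_function_def
    using stationary_value_eq_fixed_point[OF l assms(2,3), of s]
      strategy_value_le_fixed_point[OF _ assms(2,3)]
    by (intro cSup_eq_maximum) (force, blast)
qed

end

theorem theorem2p1:
  fixes A :: "(real^'k) set"
    and \<Gamma> :: "'s::polish_space \<Rightarrow> (real^'k) set"
    and p :: "'s \<Rightarrow> (real^'k) \<Rightarrow> 's measure"
    and r :: "'s \<Rightarrow> (real^'k) \<Rightarrow> real"
    and \<beta> :: real
    and D :: "('s \<Rightarrow> real) set"
  assumes "discounted_dp A \<Gamma> p r \<beta>"
    and "D \<subseteq> bounded_measurable"
    and "\<And>c. (\<lambda>_. c) \<in> D"
    and "Metric_space.mcomplete D dist_inf"
    and "bounded ((\<lambda>(s, a). r s a) ` (UNIV \<times> A))"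
    and "\<And>f. f \<in> D \<Longrightarrow> argmax_policies A \<Gamma> p r \<beta> f \<noteq> {} \<and> bellman \<Gamma> p r \<beta> f \<in> D"
  shows "(value_function A \<Gamma> p r \<beta> \<in> D \<and>
          bellman \<Gamma> p r \<beta> (value_function A \<Gamma> p r \<beta>) = value_function A \<Gamma> p r \<beta> \<and>
          (\<forall>f\<in>D. bellman \<Gamma> p r \<beta> f = f \<longrightarrow> f = value_function A \<Gamma> p r \<beta>)) \<and>
         (\<forall>\<epsilon>>0. \<exists>l\<in>argmax_policies A \<Gamma> p r \<beta> (value_function A \<Gamma> p r \<beta>).
            eps_optimal_strategy A \<Gamma> p r \<beta> \<epsilon> (stationary_strategy l)) \<and>
         (\<forall>l\<in>argmax_policies A \<Gamma> p r \<beta> (value_function A \<Gamma> p r \<beta>).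
            optimal_strategy A \<Gamma> p r \<beta> (stationary_strategy l))"
proof -
  interpret discounted_dp A \<Gamma> p r \<beta> by fact
  let ?V = "value_function A \<Gamma> p r \<beta>"
  from assms(5) obtain R where R: "\<And>s a. a \<in> A \<Longrightarrow> \<bar>r s a\<bar> \<le> R"
    unfolding bounded_iff by fastforce
  \<comment> \<open>The constant 0 lies in \<open>D\<close>, and a maximizing policy for it selects
    an element of each \<Gamma>(s).\<close>
  have "\<Gamma> s \<noteq> {}" for s
    using assms(6)[OF assms(3)[of 0]] by (auto simp: argmax_policies_def stationary_policies_def)
  then interpret bounded_discounted_dp A \<Gamma> p r \<beta> R
    using R by unfold_locales
  \<comment> \<open>This serves twice: it gives the uniqueness claim, and it transfers membership in
    \<open>D\<close> and the Bellman equation from Banach's fixed point to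
    \<open>?V\<close>.\<close>
  have unique: "?V = f" if "f \<in> D" "bellman \<Gamma> p r \<beta> f = f" for f
    using that assms(2,6) by (intro value_function_eq_fixed_point) auto
  have "D \<noteq> {}" using assms(3)[of 0] by blast
  then obtain f where f: "f \<in> D" "bellman \<Gamma> p r \<beta> f = f"
    using ex_bellman_fixed_point[OF assms(2) _ assms(4)] assms(6) by blast
  then have V: "?V \<in> D" "bellman \<Gamma> p r \<beta> ?V = ?V"
    by (simp_all add: unique[OF f])
  then have bm: "?V \<in> bounded_measurable"
    using assms(2) by auto
  have attained: "strategy_value A p r \<beta> (stationary_strategy l) s = ?V s"
    and stationary: "stationary_strategy l \<in> strategies A \<Gamma>"
    if "l \<in> argmax_policies A \<Gamma> p r \<beta> ?V" for l s
    using that stationary_value_eq_fixed_point[OF that bm V(2)]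
    by (auto simp: argmax_policies_def intro!: stationary_strategy_in_strategies)
  \<comment> \<open>Such a policy attains \<open>?V\<close>, which bounds all values, so \<epsilon>
    enters only as a nonnegative slack.\<close>
  have "eps_optimal_strategy A \<Gamma> p r \<beta> \<epsilon> (stationary_strategy l)"
    if "l \<in> argmax_policies A \<Gamma> p r \<beta> ?V" "\<epsilon> > 0" for l \<epsilon>
    unfolding eps_optimal_strategy_def
    using that strategy_value_le_fixed_point[OF _ bm V(2)]
    by (auto simp: attained stationary intro: add_increasing2)
  moreover have "optimal_strategy A \<Gamma> p r \<beta> (stationary_strategy l)"
    if "l \<in> argmax_policies A \<Gamma> p r \<beta> ?V" for l
    using that by (simp add: optimal_strategy_def attained stationary)
  \<comment> \<open>Since \<open>?V\<close> itself lies in \<open>D\<close>, the selection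
    hypothesis provides the policy demanded by the existence claim.\<close>
  moreover have "argmax_policies A \<Gamma> p r \<beta> ?V \<noteq> {}"
    using assms(6)[OF V(1)] by simp
  ultimately show ?thesis
    using V unique by blast
qed

end
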